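(* The set $\mathcal{R}_3(\mathbb{C}^2)$ of imaginarity-free triples of single-qubit density matrices is not convex: there exist $\varrho=(\rho_1,\rho_2,\rho_3)$ and $\varsigma=(\sigma_1,\sigma_2,\sigma_3)$ in $\mathcal{R}_3(\mathbb{C}^2)$ and $p\in(0,1)$ such that the triple $\xi=p\varrho+(1-p)\varsigma:=(p\rho_i+(1-p)\sigma_i)_{i=1}^3$ has imaginarity, i.e. $\xi\notin\mathcal{R}_3(\mathbb{C}^2)$.
   Context: A triple $(\rho_1,\rho_2,\rho_3)$ of density matrices (positive semidefinite, trace one) on $\mathbb{C}^2$ is imaginarity-free if there is an orthonormal basis $\{|a_1\rangle,|a_2\rangle\}$ of $\mathbb{C}^2$ such that $\langle a_i|\rho_k|a_j\rangle\in\mathbb{R}$ for all $i,j$ and all $k$; otherwise it has imaginarity. $\mathcal{R}_3(\mathbb{C}^2)$ denotes the set of imaginarity-free triples. *)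

theory Defs
  imports "HOL-Analysis.Analysis"
begin

text \<open>
  Vectors of $\mathbb{C}^n$ are elements of \<open>complex^'n\<close>, and \<open>A $ i $ j\<close> is the entry of the
  matrix \<open>A\<close> in row \<open>i\<close> and column \<open>j\<close>. The library's \<open>inner\<close> on \<open>complex^'n\<close> is real-valued,
  so the Hermitian inner product, conjugate-linear in the first argument, is introduced here.
\<close>

definition braket :: "complex^'n \<Rightarrow> complex^'n \<Rightarrow> complex" where
  "braket u v = (\<Sum>i\<in>UNIV. cnj (u $ i) * v $ i)"

definition hermitian_matrix :: "complex^'n^'n \<Rightarrow> bool" where
  "hermitian_matrix A \<longleftrightarrow> (\<forall>i j. A $ i $ j = cnj (A $ j $ i))"

text \<open>For Hermitian \<open>A\<close> the value \<open>braket x (A *v x)\<close> is real, so its real part is the whole value.\<close>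

definition positive_semidefinite :: "complex^'n^'n \<Rightarrow> bool" where
  "positive_semidefinite A \<longleftrightarrow> hermitian_matrix A \<and> (\<forall>x. 0 \<le> Re (braket x (A *v x)))"

definition density_matrix :: "complex^'n^'n \<Rightarrow> bool" where
  "density_matrix A \<longleftrightarrow> positive_semidefinite A \<and> trace A = 1"

text \<open>\<open>vec.span\<close> is the complex linear span; \<open>span\<close> would be the real one.\<close>

definition orthonormal_basis :: "('n \<Rightarrow> complex^'n) \<Rightarrow> bool" where
  "orthonormal_basis a \<longleftrightarrow>
     (\<forall>i j. braket (a i) (a j) = (if i = j then 1 else 0)) \<and> vec.span (range a) = UNIV"

text \<open>A tuple of matrices indexed by \<open>'m\<close> is an element of \<open>complex^'n^'n^'m\<close>, with \<open>k\<close>-th member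
  \<open>T $ k\<close>; triples of single-qubit matrices have type \<open>complex^2^2^3\<close>.\<close>

definition density_tuple :: "complex^'n^'n^'m \<Rightarrow> bool" where
  "density_tuple T \<longleftrightarrow> (\<forall>k. density_matrix (T $ k))"

definition imaginarity_free :: "complex^'n^'n^'m \<Rightarrow> bool" where
  "imaginarity_free T \<longleftrightarrow> density_tuple T \<and>
     (\<exists>a. orthonormal_basis a \<and> (\<forall>i j k. braket (a i) (T $ k *v a j) \<in> \<real>))"

definition has_imaginarity :: "complex^'n^'n^'m \<Rightarrow> bool" where
  "has_imaginarity T \<longleftrightarrow> density_tuple T \<and> \<not> imaginarity_free T"

definition R3_C2 :: "(complex^2^2^3) set" where
  "R3_C2 = {T. imaginarity_free T}"

end

theory Submission
  imports Defs
begin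

text \<open>
  A triple of qubit states is imaginarity-free iff its Bloch vectors are coplanar with the origin.
  The triples with Bloch vectors \<open>(e\<^sub>1, 0, e\<^sub>3)\<close> and \<open>(0, e\<^sub>2, 0)\<close> are therefore
  imaginarity-free, but their midpoint has the linearly independent Bloch vectors
  \<open>(e\<^sub>1/2, e\<^sub>2/2, e\<^sub>3/2)\<close>.
\<close>

lemma braket_axis: "braket (axis i c) (A *v axis j d) = cnj c * A $ i $ j * d"
  by (simp add: braket_def matrix_vector_mult_def axis_def if_distrib[of cnj] if_distrib[of "(*) _"]
      if_distrib[of "\<lambda>x. x * _"] cong: if_cong)

text \<open>Diagonal changes of basis suffice for both endpoint triples: unit phases preserve
  orthonormality and can only alter off-diagonal entries.\<close>

lemma orthonormal_basis_phases:
  fixes c :: "'n::finite \<Rightarrow> complex"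
  assumes "\<And>i. cnj (c i) * c i = 1"
  shows "orthonormal_basis (\<lambda>i. axis i (c i))"
proof -
  have ortho: "braket (axis i (c i)) (axis j (c j)) = (if i = j then 1 else 0)" for i j
    using assms braket_axis[of i "c i" "mat 1" j "c j"] unfolding matrix_vector_mul_lid
    by (auto simp: mat_def)
  have "v \<in> vec.span (range (\<lambda>i. axis i (c i)))" for v :: "complex^'n"
  proof -
    \<comment> \<open>The coefficients are the inner products of the basis vectors with
      \<open>v\<close>; the phases cancel in each coordinate.\<close>
    have "v = (\<Sum>i\<in>UNIV. (v $ i * cnj (c i)) *s axis i (c i))"
      using assms by (simp add: vec_eq_iff axis_def if_distrib[of "(*) _"] mult.assoc cong: if_cong)
    also have "\<dots> \<in> vec.span (range (\<lambda>i. axis i (c i)))"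
      by (intro vec.span_sum vec.span_scale vec.span_base) auto
    finally show ?thesis .
  qed
  with ortho show ?thesis
    unfolding orthonormal_basis_def by blast
qed

text \<open>This is (I + v1 X + v2 Y + v3 Z) / 2 with the Pauli matrices X, Y, Z;
  \<open>Complex\<close> keeps the real and imaginary parts of the off-diagonal entries
  visible.\<close>

definition bloch :: "real^3 \<Rightarrow> complex^2^2" where
  "bloch v = (\<chi> i j. if i = 1
     then (if j = 1 then of_real ((1 + v $ 3) / 2) else Complex (v $ 1 / 2) (- v $ 2 / 2))
     else (if j = 1 then Complex (v $ 1 / 2) (v $ 2 / 2) else of_real ((1 - v $ 3) / 2)))"

lemma bloch_nth [simp]:
  "bloch v $ 1 $ 1 = of_real ((1 + v $ 3) / 2)"
  "bloch v $ 1 $ 2 = Complex (v $ 1 / 2) (- v $ 2 / 2)"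
  "bloch v $ 2 $ 1 = Complex (v $ 1 / 2) (v $ 2 / 2)"
  "bloch v $ 2 $ 2 = of_real ((1 - v $ 3) / 2)"
  by (simp_all add: bloch_def)

text \<open>The map is affine, not linear: its constant part I/2 is preserved because the weights
  sum to 1.\<close>

lemma bloch_convex_combination:
  "bloch (p *\<^sub>R v + (1 - p) *\<^sub>R w) = p *\<^sub>R bloch v + (1 - p) *\<^sub>R bloch w"
  by (simp add: vec_eq_iff forall_2 complex_eq_iff field_simps)

lemma density_matrix_bloch:
  assumes "norm v \<le> 1"
  shows "density_matrix (bloch v)"
proof -
  define x y z where "x = v $ 1" and "y = v $ 2" and "z = v $ 3"
  have "(norm v)\<^sup>2 \<le> 1"
    using assms by (simp add: power_le_one)
  then have ball: "x\<^sup>2 + y\<^sup>2 + z\<^sup>2 \<le> 1"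
    by (simp add: x_def y_def z_def norm_vec_def L2_set_def sum_3)
  have "\<bar>z\<bar> \<le> 1"
    using ball by (simp add: abs_square_le_1[symmetric]) (smt (verit) zero_le_power2)
  have pos: "0 \<le> Re (braket u (bloch v *v u))" for u
  proof -
    define a b c d where "a = Re (u $ 1)" and "b = Im (u $ 1)" and "c = Re (u $ 2)" and "d = Im (u $ 2)"
    let ?q = "(1 + z) * (a\<^sup>2 + b\<^sup>2) + 2 * (x * (a * c + b * d) + y * (a * d - b * c)) + (1 - z) * (c\<^sup>2 + d\<^sup>2)"
    have q: "2 * Re (braket u (bloch v *v u)) = ?q"
      by (simp add: braket_def matrix_vector_mult_def sum_2 a_def b_def c_def d_def x_def y_def z_def
          field_simps power2_eq_square)
    \<comment> \<open>Complete the square with the pivot 1 + z. If the pivot is zero, the ball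
      condition forces x = y = 0 and only the last term remains.\<close>
    have "0 \<le> ?q"
    proof (cases "z = -1")
      case True
      then have "x = 0 \<and> y = 0"
        using ball by (simp add: sum_power2_le_zero_iff)
      with True show ?thesis by simp
    next
      case False
      with \<open>\<bar>z\<bar> \<le> 1\<close> have "0 < 1 + z" by linarith
      \<comment> \<open>The leftover coefficient 1 - (x^2 + y^2 + z^2) is four times the determinant
        of \<open>bloch v\<close>.\<close>
      have "(1 + z) * ?q = ((1 + z) * a + x * c + y * d)\<^sup>2 + ((1 + z) * b + x * d - y * c)\<^sup>2
          + (1 - (x\<^sup>2 + y\<^sup>2 + z\<^sup>2)) * (c\<^sup>2 + d\<^sup>2)"
        by algebra
      also have "\<dots> \<ge> 0"
        using ball by simp
      finally show ?thesis
        using \<open>0 < 1 + z\<close> by (simp add: zero_le_mult_iff)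
    qed
    with q show ?thesis by linarith
  qed
  have "hermitian_matrix (bloch v)"
    by (simp add: hermitian_matrix_def forall_2 complex_eq_iff)
  moreover have "trace (bloch v) = 1"
    by (simp add: trace_def sum_2 complex_eq_iff field_simps)
  ultimately show ?thesis
    using pos by (simp add: density_matrix_def positive_semidefinite_def)
qed

lemma imaginarity_free_by_phases:
  assumes "density_tuple T" and "\<And>i. cnj (c i) * c i = 1"
    and "\<And>i j k. cnj (c i) * T $ k $ i $ j * c j \<in> \<real>"
  shows "imaginarity_free T"
  using assms orthonormal_basis_phases[of c]
  unfolding imaginarity_free_def by (force simp: braket_axis)

lemma imaginarity_free_bloch_1_3:
  assumes "\<And>k. norm (v k) \<le> 1" and "\<And>k. v k $ 2 = 0"
  shows "imaginarity_free (\<chi> k. bloch (v k))"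
proof (rule imaginarity_free_by_phases)
  show "density_tuple (\<chi> k. bloch (v k))"
    using assms by (simp add: density_tuple_def density_matrix_bloch)
  show "cnj 1 * (\<chi> k. bloch (v k)) $ k $ i $ j * 1 \<in> \<real>" for i j k
    using exhaust_2[of i] exhaust_2[of j] assms(2)[of k]
    by (auto simp: complex_is_Real_iff)
qed simp

text \<open>Without an X component the upper off-diagonal entry is -i y / 2; giving the second basis
  vector the phase i turns it into y / 2.\<close>

lemma imaginarity_free_bloch_2_3:
  assumes "\<And>k. norm (v k) \<le> 1" and "\<And>k. v k $ 1 = 0"
  shows "imaginarity_free (\<chi> k. bloch (v k))"
proof (rule imaginarity_free_by_phases)
  let ?c = "\<lambda>i::2. if i = 1 then 1 else \<i>"
  show "density_tuple (\<chi> k. bloch (v k))"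
    using assms by (simp add: density_tuple_def density_matrix_bloch)
  show "cnj (?c i) * (\<chi> k. bloch (v k)) $ k $ i $ j * ?c j \<in> \<real>" for i j k
    using exhaust_2[of i] exhaust_2[of j] assms(2)[of k]
    by (auto simp: complex_is_Real_iff)
qed simp

text \<open>
  For an orthonormal pair \<open>a, b\<close>, reality of the off-diagonal elements of the three Pauli matrices
  makes \<open>A = cnj a\<^sub>1 b\<^sub>2\<close> and \<open>B = cnj a\<^sub>2 b\<^sub>1\<close> conjugate to each other and \<open>r = cnj a\<^sub>1 b\<^sub>1\<close>
  real, while orthogonality gives \<open>A B = - r\<^sup>2\<close>. Hence all three vanish.
\<close>

lemma not_imaginarity_free_bloch_axes:
  assumes "s \<noteq> 0"
  shows "\<not> imaginarity_free (\<chi> k. bloch (axis k s))"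
proof
  assume "imaginarity_free (\<chi> k. bloch (axis k s))"
  then obtain a where basis: "orthonormal_basis a"
    and real: "\<And>k. braket (a 1) (bloch (axis k s) *v a 2) \<in> \<real>"
    by (auto simp: imaginarity_free_def)
  define A B r t where "A = cnj (a 1 $ 1) * a 2 $ 2" and "B = cnj (a 1 $ 2) * a 2 $ 1"
    and "r = cnj (a 1 $ 1) * a 2 $ 1" and "t = cnj (a 1 $ 2) * a 2 $ 2"
  have prod: "braket (a i) (a j) = (if i = j then 1 else 0)" for i j
    using basis by (simp add: orthonormal_basis_def)
  have orth: "t = - r"
    using prod[of 1 2] by (simp add: braket_def sum_2 r_def t_def eq_neg_iff_add_eq_0 add.commute)
  have elem: "braket (a 1) (bloch v *v a 2) = of_real ((1 + v $ 3) / 2) * r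
      + Complex (v $ 1 / 2) (- v $ 2 / 2) * A + Complex (v $ 1 / 2) (v $ 2 / 2) * B
      + of_real ((1 - v $ 3) / 2) * t" for v
    unfolding A_def B_def r_def t_def
    by (simp add: braket_def matrix_vector_mult_def sum_2 distrib_left mult_ac)
  \<comment> \<open>Since \<open>t = - r\<close>, the identity part drops out. The elements for
    \<open>k\<close> = 1, 2, 3 are s (A + B) / 2, i s (B - A) / 2 and s r, and the nonzero
    \<open>s\<close> cancels.\<close>
  have "Im A + Im B = 0"
    using real[of 1] assms orth
    by (simp add: elem complex_is_Real_iff axis_def flip: distrib_left add_divide_distrib)
  moreover have "Re A = Re B"
    using real[of 2] assms orth
    by (simp add: elem complex_is_Real_iff axis_def)
  ultimately have B: "B = cnj A"
    by (simp add: complex_eq_iff)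
  have "Im r = 0"
    using real[of 3] assms orth
    by (simp add: elem complex_is_Real_iff axis_def field_simps)
  have "A * B = r * t"
    by (simp add: A_def B_def r_def t_def)
  then have "Re (A * cnj A) = Re (- (r * r))"
    using B orth by simp
  then have "(Re A)\<^sup>2 + (Im A)\<^sup>2 + (Re r)\<^sup>2 = 0"
    using \<open>Im r = 0\<close> by (simp add: power2_eq_square)
  then have "A = 0" "r = 0"
    using \<open>Im r = 0\<close> by (simp_all add: complex_eq_iff add_nonneg_eq_0_iff)
  then have "A = 0" "B = 0" "r = 0" "t = 0"
    using B orth by simp_all
  \<comment> \<open>All four products of a conjugated entry of \<open>a 1\<close> with an entry of
    \<open>a 2\<close> vanish, so one of these unit vectors would be zero.\<close>
  then have "(a 1 $ 1 = 0 \<and> a 1 $ 2 = 0) \<or> (a 2 $ 1 = 0 \<and> a 2 $ 2 = 0)"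
    by (auto simp: A_def B_def r_def t_def)
  then show False
    using prod[of 1 1] prod[of 2 2] by (auto simp: braket_def sum_2)
qed

theorem mainTheorem8:
  shows "\<not> convex R3_C2 \<and>
    (\<exists>\<rho>\<in>R3_C2. \<exists>\<sigma>\<in>R3_C2. \<exists>p::real. 0 < p \<and> p < 1 \<and>
      (\<exists>\<xi>::complex^2^2^3.
         \<xi> = (\<chi> i. p *\<^sub>R (\<rho> $ i) + (1 - p) *\<^sub>R (\<sigma> $ i)) \<and>
         has_imaginarity \<xi> \<and> \<xi> \<notin> R3_C2))"
proof -
  define v w :: "3 \<Rightarrow> real^3"
    where "v k = (if k = 2 then 0 else axis k 1)" and "w k = (if k = 2 then axis k 1 else 0)" for k
  define \<rho> \<sigma> \<xi> :: "complex^2^2^3"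
    where "\<rho> = (\<chi> k. bloch (v k))" and "\<sigma> = (\<chi> k. bloch (w k))" and "\<xi> = (\<chi> k. bloch (axis k (1/2)))"
  have \<rho>: "\<rho> \<in> R3_C2"
    unfolding R3_C2_def \<rho>_def mem_Collect_eq
    by (rule imaginarity_free_bloch_1_3) (auto simp: v_def norm_axis_1, simp add: axis_def)
  have \<sigma>: "\<sigma> \<in> R3_C2"
    unfolding R3_C2_def \<sigma>_def mem_Collect_eq
    by (rule imaginarity_free_bloch_2_3) (auto simp: w_def norm_axis_1, simp add: axis_def)
  \<comment> \<open>For each \<open>k\<close> exactly one of \<open>v k\<close> and
    \<open>w k\<close> is nonzero, so the midpoint halves every axis vector.\<close>
  have "axis k (1/2) = (1/2) *\<^sub>R v k + (1 - 1/2) *\<^sub>R w k" for k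
    by (simp add: v_def w_def vec_eq_iff axis_def)
  then have \<xi>: "\<xi> = (\<chi> k. (1/2) *\<^sub>R (\<rho> $ k) + (1 - 1/2) *\<^sub>R (\<sigma> $ k))"
    unfolding \<xi>_def \<rho>_def \<sigma>_def by (simp only: bloch_convex_combination vec_lambda_beta)
  have "norm (axis k (1/2) :: real^3) \<le> 1" for k
  proof -
    have "axis k (1/2) = (1/2) *\<^sub>R (axis k 1 :: real^3)"
      by (simp add: vec_eq_iff axis_def)
    then show ?thesis by (simp add: norm_axis_1)
  qed
  then have "density_tuple \<xi>"
    by (simp add: density_tuple_def \<xi>_def density_matrix_bloch)
  moreover have not_free: "\<not> imaginarity_free \<xi>"
    unfolding \<xi>_def by (rule not_imaginarity_free_bloch_axes) simp
  ultimately have "has_imaginarity \<xi>" "\<xi> \<notin> R3_C2"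
    by (simp_all add: has_imaginarity_def R3_C2_def)
  moreover have "\<not> convex R3_C2"
  proof
    assume "convex R3_C2"
    then have "(1/2) *\<^sub>R \<rho> + (1/2) *\<^sub>R \<sigma> \<in> R3_C2"
      using \<rho> \<sigma> by (auto intro: convexD)
    also have "(1/2) *\<^sub>R \<rho> + (1/2) *\<^sub>R \<sigma> = \<xi>"
      by (simp add: \<xi> vec_eq_iff)
    finally show False
      using \<open>\<xi> \<notin> R3_C2\<close> by simp
  qed
  moreover have "(0::real) < 1/2" "(1/2::real) < 1"
    by simp_all
  ultimately show ?thesis
    using \<rho> \<sigma> \<xi> by blast
qed

end
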